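(* Let $1\le p<+\infty$. The Gr\"unwald--Durrmeyer operators $\mathcal{D}_n:L^p[0,\pi]\to L^p[0,\pi]$ satisfy \[ \lim_{n\to\infty}\|\mathcal{D}_n(f)-f\|_p=0\qquad\text{for all } f\in L^p[0,\pi]. \]
   Context: For $n=1,2,\dots$ and $k=1,\dots,n$ let $\theta_k^{(n)}=\frac{2k-1}{2n}\pi$ and \[ P_k(t)=(-1)^{k+1}\frac{\cos(nt)\,\sin\theta_k^{(n)}}{n\,(\cos t-\cos\theta_k^{(n)})},\qquad t\in\mathbb{R}, \] where the (removable) singularities are filled in by continuity ($P_k$ depends on $n$ as well). Put \[ S_{k,n}(t)=\tfrac12\left(P_k\!\left(t-\tfrac{\pi}{2n}\right)+P_k\!\left(t+\tfrac{\pi}{2n}\right)\right). \] The $n$-th Gr\"unwald--Durrmeyer operator is defined, for $f\in L^p[0,\pi]$ ($1\le p\le+\infty$, Lebesgue measure) and $\theta\in[0,\pi]$, by \[ \mathcal{D}_n(f)(\theta)=\frac{n}{\pi}\sum_{k=1}^n S_{k,n}(\theta)\int_0^\pi f(t)\,S_{k,n}(t)\,dt . \] $\|\cdot\|_p$ is the usual norm of $L^p[0,\pi]$ with respect to Lebesgue measure. *)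

theory Defs
  imports "HOL-Analysis.Analysis"
begin

definition theta_node :: "nat \<Rightarrow> nat \<Rightarrow> real" where
  "theta_node n k = (2 * real k - 1) / (2 * real n) * pi"

definition P_quot :: "nat \<Rightarrow> nat \<Rightarrow> real \<Rightarrow> real" where
  "P_quot n k t = (-1) ^ (k + 1) * (cos (real n * t) * sin (theta_node n k))
                    / (real n * (cos t - cos (theta_node n k)))"

text \<open>For \<open>1 \<le> k \<le> n\<close> every zero of the denominator is a removable singularity of the
  quotient, so the limit below exists and \<open>P_fun n k\<close> is continuous on the real line.\<close>

definition P_fun :: "nat \<Rightarrow> nat \<Rightarrow> real \<Rightarrow> real" where
  "P_fun n k t = (if cos t = cos (theta_node n k) then Lim (at t) (P_quot n k) else P_quot n k t)"

definition S_fun :: "nat \<Rightarrow> nat \<Rightarrow> real \<Rightarrow> real" where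
  "S_fun n k t = (P_fun n k (t - pi / (2 * real n)) + P_fun n k (t + pi / (2 * real n))) / 2"

definition grunwald_durrmeyer :: "nat \<Rightarrow> (real \<Rightarrow> real) \<Rightarrow> real \<Rightarrow> real" where
  "grunwald_durrmeyer n f \<theta> =
     real n / pi * (\<Sum>k = 1..n. S_fun n k \<theta> * (\<integral>t. f t * S_fun n k t \<partial>(lebesgue_on {0..pi})))"

text \<open>Elements of \<open>L\<^sup>p[0,\<pi>]\<close> are given by representatives, i.e. by functions on the real line
  of which only the restriction to \<open>[0,\<pi>]\<close> matters. Since the Bochner integral of a
  non-integrable function is \<open>0\<close>, \<open>Lp_norm p f\<close> is meaningful only for \<open>f \<in> Lp_space p\<close>.\<close>

definition Lp_space :: "real \<Rightarrow> (real \<Rightarrow> real) set" where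
  "Lp_space p = {f \<in> borel_measurable (lebesgue_on {0..pi}).
                   integrable (lebesgue_on {0..pi}) (\<lambda>t. \<bar>f t\<bar> powr p)}"

definition Lp_norm :: "real \<Rightarrow> (real \<Rightarrow> real) \<Rightarrow> real" where
  "Lp_norm p f = (\<integral>t. \<bar>f t\<bar> powr p \<partial>(lebesgue_on {0..pi})) powr (1 / p)"

end

theory Submission
  imports Defs
begin

text \<open>
  Each \<open>P_k\<close> is a cosine polynomial (Christoffel--Darboux), and the discrete orthogonality of the
  cosines at the Chebyshev nodes turns the operator into a cosine multiplier: it multiplies the
  \<open>j\<close>-th cosine coefficient, \<open>j < n\<close>, by \<open>cos\<^sup>2 (j \<pi> / (2 n))\<close>. The second differences of these
  multipliers are \<open>O(1 / n\<^sup>2)\<close>, so summation by parts bounds the kernel pointwise by a nonnegative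
  combination of Fejer kernels of total mass bounded in \<open>n\<close>; by Jensen's inequality the operators
  are uniformly bounded on \<open>L\<^sup>p\<close>. The multipliers tend to \<open>1\<close>, so there is convergence on cosine
  polynomials, and these are dense. All kernels are finite sums of products, which makes
  Fubini's theorem unnecessary.
\<close>

subsection \<open>Interpolation at the Chebyshev nodes\<close>

text \<open>Reciprocal of the mean of cos^2 (j t), over [0, pi] and, for j < n, over the n nodes; it
  lets the constant term share one formula with the other frequencies.\<close>

definition cos_wt :: "nat \<Rightarrow> real" where
  "cos_wt j = (if j = 0 then 1 else 2)"

lemma cos_wt_simps [simp]: "cos_wt 0 = 1" "cos_wt (Suc j) = 2"
  by (auto simp: cos_wt_def)

lemma cos_wt_nonzero [simp]: "cos_wt j \<noteq> 0"
  by (simp add: cos_wt_def)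

text \<open>The induction step is the recurrence cos ((n + 2) u) = 2 cos u cos ((n + 1) u) - cos (n
  u), applied at u = s and at u = t.\<close>

lemma cos_christoffel_darboux:
  fixes s t :: real
  shows "(cos t - cos s) * (\<Sum>j<Suc n. cos_wt j * cos (real j * s) * cos (real j * t))
    = cos (real (Suc n) * t) * cos (real n * s) - cos (real n * t) * cos (real (Suc n) * s)"
proof (induction n)
  case (Suc n)
  have "cos (x + u) = 2 * cos u * cos x - cos (x - u)" for x u :: real
    by (simp add: cos_add cos_diff)
  from this[of "real (Suc n) * u" u for u]
  have cos2: "cos (real (Suc (Suc n)) * u) = 2 * cos u * cos (real (Suc n) * u) - cos (real n * u)" for u :: real
    by (simp add: algebra_simps)
  have "(cos t - cos s) * (\<Sum>j<Suc (Suc n). cos_wt j * cos (real j * s) * cos (real j * t))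
    = (cos t - cos s) * (\<Sum>j<Suc n. cos_wt j * cos (real j * s) * cos (real j * t))
      + (cos t - cos s) * (2 * cos (real (Suc n) * s) * cos (real (Suc n) * t))"
    by (simp only: sum.lessThan_Suc[of _ "Suc n"] cos_wt_simps distrib_left)
  then show ?case
    unfolding Suc.IH cos2[of s] cos2[of t] by algebra
qed simp

lemma theta_node_bounds:
  assumes "1 \<le> k" "k \<le> n"
  shows "0 < theta_node n k" "theta_node n k < pi"
proof -
  show "0 < theta_node n k"
    using assms by (auto simp: theta_node_def)
  have "(2 * real k - 1) / (2 * real n) < 1"
    using assms by (simp add: divide_simps)
  then show "theta_node n k < pi"
    unfolding theta_node_def using pi_gt_zero by (metis mult_strict_right_mono mult_1)
qed

lemma cos_sin_theta_node:
  assumes "1 \<le> k" "k \<le> n"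
  shows "cos (real n * theta_node n k) = 0" "sin (real n * theta_node n k) = (-1) ^ (k + 1)"
proof -
  obtain i where k: "k = Suc i" using assms by (cases k) auto
  have eq: "real n * theta_node n k = pi / 2 + real i * pi"
    using assms by (simp add: theta_node_def k field_simps)
  show "cos (real n * theta_node n k) = 0"
    unfolding eq by (simp add: cos_add)
  show "sin (real n * theta_node n k) = (-1) ^ (k + 1)"
    unfolding eq by (simp add: sin_add k)
qed

text \<open>Take s to be the node in the Christoffel-Darboux identity with \<open>n = Suc m\<close>.
  As cos (n s) = 0, only one product on the right survives, and its factor cos ((n - 1) s) = sin (n
  s) sin s accounts for both the sign and the sine in \<open>P_quot\<close>.\<close>

lemma P_quot_eq:
  assumes k: "1 \<le> k" "k \<le> n" and ne: "cos t \<noteq> cos (theta_node n k)"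
  shows "P_quot n k t = (\<Sum>j<n. cos_wt j * cos (real j * theta_node n k) * cos (real j * t)) / real n"
proof -
  define s where "s = theta_node n k"
  obtain m where n: "n = Suc m" using k by (cases n) auto
  have ns: "cos (real n * s) = 0" "sin (real n * s) = (-1) ^ (k + 1)"
    using cos_sin_theta_node[OF k] by (auto simp: s_def)
  have "real m * s = real n * s - s" by (simp add: n algebra_simps)
  then have "cos (real m * s) = (-1) ^ (k + 1) * sin s"
    by (simp only: cos_diff ns mult_zero_left add_0)
  then have "(cos t - cos s) * (\<Sum>j<n. cos_wt j * cos (real j * s) * cos (real j * t))
      = (-1) ^ (k + 1) * (cos (real n * t) * sin s)"
    using cos_christoffel_darboux[of t s m] ns unfolding n by simp
  then have "(\<Sum>j<n. cos_wt j * cos (real j * s) * cos (real j * t)) * (cos t - cos s)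
      = (-1) ^ (k + 1) * (cos (real n * t) * sin s)"
    by (subst mult.commute)
  moreover have "cos t - cos s \<noteq> 0" using ne by (simp add: s_def)
  ultimately have "(\<Sum>j<n. cos_wt j * cos (real j * s) * cos (real j * t))
      = (-1) ^ (k + 1) * (cos (real n * t) * sin s) / (cos t - cos s)"
    by (rule eq_divide_imp[rotated])
  then show ?thesis
    unfolding P_quot_def s_def[symmetric] by (simp add: mult.commute)
qed

lemma P_fun_eq:
  assumes k: "1 \<le> k" "k \<le> n"
  shows "P_fun n k t = (\<Sum>j<n. cos_wt j * cos (real j * theta_node n k) * cos (real j * t)) / real n"
    (is "_ = ?A t")
proof (cases "cos t = cos (theta_node n k)")
  case True
  have "sin (theta_node n k) > 0"
    using theta_node_bounds[OF k] by (intro sin_gt_zero)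
  moreover have "(sin t)\<^sup>2 = (sin (theta_node n k))\<^sup>2"
    by (simp add: sin_squared_eq True)
  ultimately have "sin t \<noteq> 0" by auto
  moreover have "(cos has_real_derivative - sin t) (at t)"
    by (auto intro!: derivative_eq_intros)
  \<comment> \<open>The derivative of cosine at t is nonzero, so cos x differs from cos t for x near
    t, x not equal to t. There the quotient agrees with the continuous cosine sum, whose value at t
    is therefore the limit.\<close>
  ultimately have "eventually (\<lambda>x. (cos x - cos t) / (x - t) \<noteq> 0) (at t)"
    unfolding has_field_derivative_iff by (intro tendsto_imp_eventually_ne[of _ "- sin t"]) auto
  then have ev: "eventually (\<lambda>x. ?A x = P_quot n k x) (at t)"
    by eventually_elim (simp add: P_quot_eq[OF k] True)
  have "(?A \<longlongrightarrow> ?A t) (at t)"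
    by (intro tendsto_intros) (use k in auto)
  then have "(P_quot n k \<longlongrightarrow> ?A t) (at t)"
    using tendsto_cong[OF ev] by simp
  then have "Lim (at t) (P_quot n k) = ?A t"
    by (intro tendsto_Lim) auto
  then show ?thesis using True by (simp add: P_fun_def)
qed (simp add: P_fun_def P_quot_eq[OF k])

text \<open>Averaging the two shifts by h = pi / (2 n) cancels the sine terms and multiplies
  frequency j by cos (j h).\<close>

lemma S_fun_eq:
  assumes k: "1 \<le> k" "k \<le> n"
  shows "S_fun n k t = (\<Sum>j<n. cos_wt j * cos (real j * (pi / (2 * real n)))
     * cos (real j * theta_node n k) * cos (real j * t)) / real n"
proof -
  define h where "h = pi / (2 * real n)"
  define c where "c j = cos_wt j * cos (real j * theta_node n k)" for j
  have "(\<Sum>j<n. c j * cos (real j * (t - h))) + (\<Sum>j<n. c j * cos (real j * (t + h)))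
      = 2 * (\<Sum>j<n. cos_wt j * cos (real j * h) * cos (real j * theta_node n k) * cos (real j * t))"
    unfolding sum.distrib[symmetric] sum_distrib_left
    by (rule sum.cong) (auto simp: c_def distrib_left right_diff_distrib cos_add cos_diff algebra_simps)
  then show ?thesis
    unfolding S_fun_def P_fun_eq[OF k] h_def[symmetric] c_def[symmetric]
    by (simp only: add_divide_distrib[symmetric]) simp
qed

section \<open>Discrete orthogonality of the cosines at the nodes\<close>

lemma sum_cos_theta_node:
  assumes m: "0 < m" "m < 2 * n"
  shows "(\<Sum>k=1..n. cos (real m * theta_node n k)) = 0"
proof -
  define h where "h = real m * pi / (2 * real n)"
  have n: "n > 0" using m by auto
  have "0 < h" "h < pi" using m n by (auto simp: h_def field_simps)
  then have sh: "sin h > 0" by (rule sin_gt_zero)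
  \<comment> \<open>The argument at the k-th node is (2 k - 1) h, so multiplication by 2 sin h makes
    the sum telescope. At N = n it becomes sin (m pi) = 0, while m < 2 n keeps sin h
    nonzero.\<close>
  have "2 * sin h * (\<Sum>k=1..N. cos (real m * theta_node n k)) = sin (2 * real N * h)" for N
  proof (induction N)
    case (Suc N)
    have e: "real m * theta_node n (Suc N) = 2 * real N * h + h"
      using n by (simp add: theta_node_def h_def field_simps)
    have "2 * sin h * cos x = sin (x + h) - sin (x - h)" for x
      by (simp add: sin_add sin_diff)
    from this[of "2 * real N * h + h"] show ?case using Suc by (simp add: e algebra_simps)
  qed simp
  from this[of n] have "2 * sin h * (\<Sum>k=1..n. cos (real m * theta_node n k)) = 0"
    using n by (simp add: h_def)
  then show ?thesis using sh by simp
qed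

lemma discrete_orthogonality:
  assumes "i < n" "j < n"
  shows "(\<Sum>k=1..n. cos (real i * theta_node n k) * cos (real j * theta_node n k))
     = (if i = j then real n / cos_wt i else 0)"
proof -
  have main: "(\<Sum>k=1..n. cos (real i * theta_node n k) * cos (real j * theta_node n k))
     = (if i = j then real n / cos_wt i else 0)" if ij: "i \<le> j" "j < n" for i j
  proof -
    \<comment> \<open>Product to sum: the frequencies j - i and i + j are both below 2 n, so a sum
      over the nodes vanishes unless its frequency is 0.\<close>
    have *: "cos (real i * x) * cos (real j * x) = (cos (real (j - i) * x) + cos (real (i + j) * x)) / 2" for x
      using ij by (simp add: algebra_simps of_nat_diff cos_add cos_diff)
    show ?thesis
    proof (cases "i = j")
      case True
      then show ?thesis using ij sum_cos_theta_node[of "i + j" n] unfolding *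
        by (cases "i = 0") (auto simp: sum_divide_distrib[symmetric] sum.distrib cos_wt_def)
    next
      case False
      then show ?thesis using ij sum_cos_theta_node[of "i + j" n] sum_cos_theta_node[of "j - i" n]
        unfolding * by (auto simp: sum_divide_distrib[symmetric] sum.distrib)
    qed
  qed
  show ?thesis
    using main[of i j] main[of j i] assms by (cases "i \<le> j") (auto simp: mult.commute)
qed

subsection \<open>The operator as a cosine multiplier\<close>

abbreviation mu :: "real measure" where "mu \<equiv> lebesgue_on {0..pi}"

lemma integrable_mult_continuous:
  fixes f g :: "real \<Rightarrow> real"
  assumes f: "integrable mu f" and g: "continuous_on {0..pi} g"
  shows "integrable mu (\<lambda>t. f t * g t)"
proof -
  have "compact (g ` {0..pi})" using g by (intro compact_continuous_image) auto
  then obtain B where B: "\<And>x. x \<in> {0..pi} \<Longrightarrow> \<bar>g x\<bar> \<le> B"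
    using compact_imp_bounded[of "g ` {0..pi}"] by (fastforce simp: bounded_iff)
  have gm: "g \<in> borel_measurable mu"
    using g by (intro continuous_imp_measurable_on_sets_lebesgue) auto
  show ?thesis
  proof (rule Bochner_Integration.integrable_bound)
    show "integrable mu (\<lambda>t. B * f t)" using f by simp
    show "(\<lambda>t. f t * g t) \<in> borel_measurable mu" using f gm by measurable
    show "AE x in mu. norm (f x * g x) \<le> norm (B * f x)"
    proof (rule AE_I2)
      fix x assume "x \<in> space mu"
      then have "\<bar>g x\<bar> \<le> \<bar>B\<bar>" using B[of x] by auto
      then show "norm (f x * g x) \<le> norm (B * f x)"
        using mult_left_mono[of "\<bar>g x\<bar>" "\<bar>B\<bar>" "\<bar>f x\<bar>"] by (simp add: abs_mult mult.commute)
    qed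
  qed
qed

lemma integral_cos_mult:
  "(\<integral>t. cos (real j * t) \<partial>mu) = (if j = 0 then pi else 0)"
proof -
  have "integrable mu (\<lambda>t. cos (real j * t))"
    by (intro continuous_imp_integrable_real continuous_intros)
  then have "(\<integral>t. cos (real j * t) \<partial>mu) = integral {0..pi} (\<lambda>t. cos (real j * t))"
    by (intro lebesgue_integral_eq_integral) auto
  also have "\<dots> = (if j = 0 then pi else 0)"
  proof (cases "j = 0")
    case False
    have "((\<lambda>t. cos (real j * t)) has_integral (sin (real j * pi) / real j - sin (real j * 0) / real j)) {0..pi}"
      using False
      by (intro fundamental_theorem_of_calculus)
        (auto intro!: derivative_eq_intros simp flip: has_real_derivative_iff_has_vector_derivative)
    then show ?thesis using False by (auto simp: integral_unique)
  qed simp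
  finally show ?thesis .
qed

lemma integral_cos_cos:
  "(\<integral>t. cos (real i * t) * cos (real j * t) \<partial>mu) = (if i = j then pi / cos_wt i else 0)"
proof -
  have main: "(\<integral>t. cos (real i * t) * cos (real j * t) \<partial>mu) = (if i = j then pi / cos_wt i else 0)"
    if "i \<le> j" for i j
  proof -
    have I: "integrable mu (\<lambda>t. cos (real m * t))" for m
      by (intro continuous_imp_integrable_real continuous_intros)
    have "cos (real i * t) * cos (real j * t) = (cos (real (j - i) * t) + cos (real (i + j) * t)) / 2" for t
      using that by (simp add: algebra_simps of_nat_diff cos_add cos_diff)
    then have "(\<lambda>t. cos (real i * t) * cos (real j * t))
      = (\<lambda>t. (cos (real (j - i) * t) + cos (real (i + j) * t)) / 2)" by (rule ext)
    then have "(\<integral>t. cos (real i * t) * cos (real j * t) \<partial>mu)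
       = ((\<integral>t. cos (real (j - i) * t) \<partial>mu) + (\<integral>t. cos (real (i + j) * t) \<partial>mu)) / 2"
      using I by (simp only: Bochner_Integration.integral_add integral_divide_zero)
    then show ?thesis using that unfolding integral_cos_mult by (auto simp: cos_wt_def)
  qed
  show ?thesis
    using main[of i j] main[of j i] by (cases "i \<le> j") (auto simp: mult.commute)
qed

section \<open>Kernels that are finite cosine sums\<close>

definition cos_kernel :: "nat \<Rightarrow> (nat \<Rightarrow> real) \<Rightarrow> real \<Rightarrow> real \<Rightarrow> real" where
  "cos_kernel n b x t = (\<Sum>j<n. b j * cos (real j * x) * cos (real j * t))"

lemma continuous_on_cos_kernel [continuous_intros]:
  "continuous_on A (cos_kernel n b x)"
  unfolding cos_kernel_def by (intro continuous_intros)

lemma cos_kernel_sum: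
  "(\<Sum>i\<in>I. c i * cos_kernel n (b i) x t) = cos_kernel n (\<lambda>j. \<Sum>i\<in>I. c i * b i j) x t"
  unfolding cos_kernel_def sum_distrib_left sum_distrib_right
  by (subst sum.swap) (simp add: mult_ac)

text \<open>The variables separate, so only finitely many cosine coefficients of \<open>g\<close>
  enter and the result is a cosine sum in x. Its continuity and its integral over x are read off
  from this form.\<close>

lemma integral_cos_kernel:
  assumes "integrable mu g"
  shows "(\<integral>t. g t * cos_kernel n b x t \<partial>mu)
    = (\<Sum>j<n. b j * (\<integral>t. g t * cos (real j * t) \<partial>mu) * cos (real j * x))"
proof -
  have I: "integrable mu (\<lambda>t. g t * cos (real j * t))" for j
    by (intro integrable_mult_continuous assms continuous_intros)
  have "g t * cos_kernel n b x t = (\<Sum>j<n. b j * cos (real j * x) * (g t * cos (real j * t)))" for t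
    by (simp add: cos_kernel_def sum_distrib_left mult_ac)
  then have "(\<integral>t. g t * cos_kernel n b x t \<partial>mu)
    = (\<integral>t. (\<Sum>j<n. b j * cos (real j * x) * (g t * cos (real j * t))) \<partial>mu)" by presburger
  also have "\<dots> = (\<Sum>j<n. b j * cos (real j * x) * (\<integral>t. g t * cos (real j * t) \<partial>mu))"
    using I by simp
  finally show ?thesis by (simp add: mult_ac)
qed

lemma continuous_on_integral_cos_kernel:
  assumes "integrable mu g"
  shows "continuous_on A (\<lambda>x. \<integral>t. g t * cos_kernel n b x t \<partial>mu)"
  unfolding integral_cos_kernel[OF assms] by (intro continuous_intros)

text \<open>Stands in for Fubini: the inner integral is a cosine sum in x, and integration over x
  leaves its frequency 0 only.\<close>

lemma double_integral_cos_kernel: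
  assumes "integrable mu g" "n > 0"
  shows "(\<integral>x. (\<integral>t. g t * cos_kernel n b x t \<partial>mu) \<partial>mu) = pi * b 0 * (\<integral>t. g t \<partial>mu)"
proof -
  have "integrable mu (\<lambda>t. cos (real m * t))" for m
    by (intro continuous_imp_integrable_real continuous_intros)
  then have "(\<integral>x. (\<integral>t. g t * cos_kernel n b x t \<partial>mu) \<partial>mu)
    = (\<Sum>j<n. b j * (\<integral>t. g t * cos (real j * t) \<partial>mu) * (if j = 0 then pi else 0))"
    unfolding integral_cos_kernel[OF assms(1)] by (simp add: integral_cos_mult)
  also have "\<dots> = (\<Sum>j<n. if j = 0 then pi * b 0 * (\<integral>t. g t \<partial>mu) else 0)"
    by (intro sum.cong) auto
  also have "\<dots> = pi * b 0 * (\<integral>t. g t \<partial>mu)" using assms(2) by simp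
  finally show ?thesis .
qed

text \<open>The mass of the kernel does not depend on x, which is why a majorant can be controlled
  through \<open>pi * b 0\<close> alone.\<close>

lemma integral_cos_kernel_1:
  assumes "n > 0"
  shows "(\<integral>t. cos_kernel n b x t \<partial>mu) = pi * b 0"
proof -
  have "(\<integral>t. 1 * cos_kernel n b x t \<partial>mu) = (\<Sum>j<n. if j = 0 then pi * b 0 else 0)"
    by (subst integral_cos_kernel)
       (auto simp: integral_cos_mult continuous_imp_integrable_real simp del: sum.delta intro!: sum.cong)
  then show ?thesis using assms by simp
qed

lemma grunwald_durrmeyer_eq:
  assumes n: "n \<ge> 1" and f: "integrable mu f"
  shows "grunwald_durrmeyer n f x
    = (\<integral>t. f t * cos_kernel n (\<lambda>j. cos_wt j * (cos (real j * (pi / (2 * real n))))\<^sup>2 / pi) x t \<partial>mu)"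
proof -
  define c where "c j = cos_wt j * cos (real j * (pi / (2 * real n)))" for j
  let ?e = "\<lambda>k j. cos (real j * theta_node n k)"
  have S: "S_fun n k t = (\<Sum>j<n. c j * ?e k j * cos (real j * t)) / real n" if "k \<in> {1..n}" for k t
    using S_fun_eq[of k n t] that by (simp add: c_def)
  have "continuous_on {0..pi} (S_fun n k)" if "k \<in> {1..n}" for k
    unfolding S[OF that, abs_def] using n by (intro continuous_intros) auto
  then have I: "integrable mu (\<lambda>t. f t * S_fun n k t)" if "k \<in> {1..n}" for k
    using that by (intro integrable_mult_continuous f)
  have "grunwald_durrmeyer n f x
     = real n / pi * (\<Sum>k=1..n. (\<integral>t. S_fun n k x * (f t * S_fun n k t) \<partial>mu))"
    unfolding grunwald_durrmeyer_def by simp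
  also have "\<dots> = (\<integral>t. real n / pi * (\<Sum>k=1..n. S_fun n k x * (f t * S_fun n k t)) \<partial>mu)"
    using I by (subst Bochner_Integration.integral_sum[symmetric]) (auto simp del: times_divide_eq_left)
  also have "(\<lambda>t. real n / pi * (\<Sum>k=1..n. S_fun n k x * (f t * S_fun n k t)))
    = (\<lambda>t. f t * cos_kernel n (\<lambda>j. cos_wt j * (cos (real j * (pi / (2 * real n))))\<^sup>2 / pi) x t)"
  proof
    fix t
    have "(\<Sum>k=1..n. S_fun n k x * S_fun n k t)
      = (\<Sum>k=1..n. \<Sum>i<n. \<Sum>j<n. (c i * ?e k i * cos (real i * x)) * (c j * ?e k j * cos (real j * t)) / (real n)\<^sup>2)"
      by (intro sum.cong refl, subst (1 2) S)
        (simp_all only: sum_product times_divide_times_eq power2_eq_square sum_divide_distrib)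
    \<comment> \<open>With the sum over k innermost, discrete orthogonality reduces the double sum
      over frequencies to its diagonal.\<close>
    also have "\<dots> = (\<Sum>i<n. \<Sum>j<n. \<Sum>k=1..n. (c i * ?e k i * cos (real i * x)) * (c j * ?e k j * cos (real j * t)) / (real n)\<^sup>2)"
      by (rule trans[OF sum.swap], rule sum.cong[OF refl], rule sum.swap)
    also have "\<dots> = (\<Sum>i<n. \<Sum>j<n. c i * cos (real i * x) * c j * cos (real j * t) / (real n)\<^sup>2 * (\<Sum>k=1..n. ?e k i * ?e k j))"
      unfolding sum_distrib_left by (intro sum.cong refl) simp
    also have "\<dots> = (\<Sum>i<n. \<Sum>j<n. if j = i then c i * cos (real i * x) * c i * cos (real i * t) / (real n * cos_wt i) else 0)"
      using n by (intro sum.cong refl, subst discrete_orthogonality) (auto simp: power2_eq_square mult_ac)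
    also have "\<dots> = (\<Sum>i<n. c i * cos (real i * x) * c i * cos (real i * t) / (real n * cos_wt i))"
      by (simp add: sum.delta)
    finally have eq: "(\<Sum>k=1..n. S_fun n k x * S_fun n k t) = \<dots>" .
    have "real n / pi * (\<Sum>k=1..n. S_fun n k x * (f t * S_fun n k t))
      = f t * (real n / pi * (\<Sum>k=1..n. S_fun n k x * S_fun n k t))"
      by (simp add: sum_distrib_left mult_ac)
    \<comment> \<open>The constants combine: n / pi times cos_wt^2 / (n cos_wt) is cos_wt / pi. The
      cosine is squared because each of the two factors \<open>S_fun\<close> contributes it
      once.\<close>
    also have "real n / pi * (\<Sum>k=1..n. S_fun n k x * S_fun n k t)
      = cos_kernel n (\<lambda>j. cos_wt j * (cos (real j * (pi / (2 * real n))))\<^sup>2 / pi) x t"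
      unfolding eq cos_kernel_def sum_distrib_left using n
      by (intro sum.cong refl) (auto simp: c_def power2_eq_square field_simps)
    finally show "real n / pi * (\<Sum>k=1..n. S_fun n k x * (f t * S_fun n k t))
      = f t * cos_kernel n (\<lambda>j. cos_wt j * (cos (real j * (pi / (2 * real n))))\<^sup>2 / pi) x t" .
  qed
  finally show ?thesis .
qed

subsection \<open>A majorant of the kernel\<close>

text \<open>Both sides are n times the Fejer kernel, the right one being the squared modulus of the
  sum of e^(i l u) over l < n. Passing to n + 1 adds a Dirichlet kernel on the left and 1 plus the
  cross terms with e^(i n u) on the right.\<close>

lemma fejer_sum_squares:
  fixes u :: real
  shows "(\<Sum>l<n. real (n - l) * cos_wt l * cos (real l * u))
    = (\<Sum>l<n. cos (real l * u))\<^sup>2 + (\<Sum>l<n. sin (real l * u))\<^sup>2"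
proof (induction n)
  case (Suc n)
  let ?C = "\<Sum>l<n. cos (real l * u)" and ?S = "\<Sum>l<n. sin (real l * u)"
  have "(\<Sum>l<Suc n. real (Suc n - l) * cos_wt l * cos (real l * u))
    = (\<Sum>l<Suc n. real (n - l) * cos_wt l * cos (real l * u) + cos_wt l * cos (real l * u))"
    by (intro sum.cong refl) (auto simp: Suc_diff_le algebra_simps)
  also have "\<dots> = ?C\<^sup>2 + ?S\<^sup>2 + (\<Sum>l<Suc n. cos_wt l * cos (real l * u))"
    unfolding sum.distrib using Suc.IH by simp
  also have "(\<Sum>l<Suc n. cos_wt l * cos (real l * u)) = 1 + 2 * (\<Sum>l<n. cos (real (Suc l) * u))"
    unfolding sum.lessThan_Suc_shift by (simp add: sum_distrib_left)
  \<comment> \<open>Reversing the order produces cos ((n - l) u), whose addition formula gives the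
    cross terms.\<close>
  also have "(\<Sum>l<n. cos (real (Suc l) * u)) = (\<Sum>l<n. cos (real (n - l) * u))"
    by (rule sum.reindex_bij_witness[of _ "\<lambda>l. n - Suc l" "\<lambda>l. n - Suc l"]) (auto simp: Suc_diff_Suc)
  also have "\<dots> = (\<Sum>l<n. cos (real l * u) * cos (real n * u) + sin (real l * u) * sin (real n * u))"
    by (intro sum.cong refl) (auto simp: of_nat_diff left_diff_distrib cos_diff)
  also have "\<dots> = ?C * cos (real n * u) + ?S * sin (real n * u)"
    by (simp add: sum.distrib sum_distrib_right)
  finally have eq: "(\<Sum>l<Suc n. real (Suc n - l) * cos_wt l * cos (real l * u))
    = ?C\<^sup>2 + ?S\<^sup>2 + (1 + 2 * (?C * cos (real n * u) + ?S * sin (real n * u)))" .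
  have "(cos (real n * u))\<^sup>2 + (sin (real n * u))\<^sup>2 = 1" by simp
  then show ?case unfolding eq sum.lessThan_Suc[of _ n] by algebra
qed simp

text \<open>The truncated subtraction pads the coefficients with zeros from index \<open>m\<close> on, so that Fejer
  kernels of different orders become \<open>cos_kernel\<close>s of the same length.\<close>

definition fejer_coeff :: "nat \<Rightarrow> nat \<Rightarrow> real" where
  "fejer_coeff m l = real (m - l) * cos_wt l"

text \<open>Since 2 cos (l x) cos (l t) = cos (l (x - t)) + cos (l (x + t)), twice the kernel is a
  sum of two unnormalised Fejer kernels, each a sum of squares.\<close>

lemma fejer_kernel_nonneg:
  assumes "m \<le> n"
  shows "cos_kernel n (fejer_coeff m) x t \<ge> 0"
proof -
  have "0 \<le> (\<Sum>l<m. real (m - l) * cos_wt l * cos (real l * (x - t)))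
     + (\<Sum>l<m. real (m - l) * cos_wt l * cos (real l * (x + t)))"
    unfolding fejer_sum_squares by simp
  also have "\<dots> = 2 * cos_kernel m (fejer_coeff m) x t"
    unfolding cos_kernel_def fejer_coeff_def sum.distrib[symmetric] sum_distrib_left
    by (intro sum.cong refl) (auto simp: distrib_left right_diff_distrib cos_add cos_diff algebra_simps)
  also have "cos_kernel m (fejer_coeff m) x t = cos_kernel n (fejer_coeff m) x t"
    unfolding cos_kernel_def using assms
    by (intro sum.mono_neutral_left) (auto simp: fejer_coeff_def)
  finally show ?thesis by simp
qed

text \<open>Two summations by parts against the ramp \<open>Suc j - l\<close>. Truncation makes the
  ramp zero for j < l, so the induction can start at n = l, where both sides are 0.\<close>

lemma second_difference_expansion:
  fixes a :: "nat \<Rightarrow> real"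
  assumes "l \<le> n"
  shows "(\<Sum>j<n. (a j - 2 * a (Suc j) + a (Suc (Suc j))) * real (Suc j - l))
    = a l - real (Suc n - l) * a n + real (n - l) * a (Suc n)"
  using assms
proof (induction n rule: dec_induct)
  case base
  show ?case by (simp add: Suc_diff_le)
next
  case (step n)
  then have "Suc n - l = Suc (n - l)" "Suc (Suc n) - l = Suc (Suc (n - l))" by auto
  then show ?case using step.IH by (simp add: algebra_simps)
qed

text \<open>The multiplier vanishes at \<open>n\<close>, so only the boundary term with \<open>a (Suc n)\<close> remains in the
  summation by parts; \<open>d (n - 1)\<close> absorbs it.\<close>

lemma grunwald_multiplier_expansion:
  assumes n: "n \<ge> 1"
  obtains d where "\<And>l. l < n \<Longrightarrow> (cos (real l * (pi / (2 * real n))))\<^sup>2 = (\<Sum>j<n. d j * real (Suc j - l))"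
    "\<And>j. \<bar>d j\<bar> \<le> 3 * (pi / (2 * real n))\<^sup>2"
proof -
  define h where "h = pi / (2 * real n)"
  define a where "a j = (cos (real j * h))\<^sup>2" for j
  define d where "d j = a j - 2 * a (Suc j) + a (Suc (Suc j)) - (if Suc j = n then a (Suc n) else 0)" for j
  have nh: "real n * h = pi / 2" using n by (simp add: h_def)
  have an: "a n = 0" by (simp add: a_def nh)
  have s: "(sin h)\<^sup>2 \<le> h\<^sup>2"
    using abs_sin_x_le_abs_x[of h] by (simp only: abs_le_square_iff)
  have "a (Suc n) = (sin h)\<^sup>2"
    by (simp add: a_def distrib_right nh cos_add)
  then have aS: "\<bar>a (Suc n)\<bar> \<le> h\<^sup>2" using s by simp
  \<comment> \<open>The second difference of cos^2 with step h, centred at y = (j + 1) h, is - 2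
    sin^2 h cos (2 y). Its bound 2 h^2 and the bound h^2 for the boundary value
    \<open>a (Suc n)\<close> add up to the constant 3.\<close>
  have diff: "\<bar>a j - 2 * a (Suc j) + a (Suc (Suc j))\<bar> \<le> 2 * h\<^sup>2" for j
  proof -
    have "a j - 2 * a (Suc j) + a (Suc (Suc j)) = (cos (y - h))\<^sup>2 - 2 * (cos y)\<^sup>2 + (cos (y + h))\<^sup>2"
      if "y = real (Suc j) * h" for y
      using that by (simp add: a_def algebra_simps)
    moreover have "(cos (y - h))\<^sup>2 - 2 * (cos y)\<^sup>2 + (cos (y + h))\<^sup>2 = - 2 * (sin h)\<^sup>2 * cos (2 * y)" for y
    proof -
      have "(cos y)\<^sup>2 + (sin y)\<^sup>2 = 1" "(cos h)\<^sup>2 + (sin h)\<^sup>2 = 1" by auto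
      then show ?thesis unfolding cos_add cos_diff cos_double by algebra
    qed
    ultimately have "\<bar>a j - 2 * a (Suc j) + a (Suc (Suc j))\<bar> = 2 * (sin h)\<^sup>2 * \<bar>cos (2 * (real (Suc j) * h))\<bar>"
      by (simp add: abs_mult)
    also have "\<dots> \<le> 2 * h\<^sup>2 * 1" using s by (intro mult_mono) auto
    finally show ?thesis by simp
  qed
  show thesis
  proof (rule that[of d])
    fix l assume l: "l < n"
    \<comment> \<open>At j = n - 1 the ramp equals n - l, so the correction in \<open>d\<close>
      cancels the remaining boundary term.\<close>
    have "(\<Sum>j<n. d j * real (Suc j - l))
      = (\<Sum>j<n. (a j - 2 * a (Suc j) + a (Suc (Suc j))) * real (Suc j - l))
        - (\<Sum>j<n. if j = n - 1 then a (Suc n) * real (n - l) else 0)"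
      unfolding sum_subtractf[symmetric] using n by (intro sum.cong refl) (auto simp: d_def algebra_simps)
    also have "\<dots> = a l"
      using second_difference_expansion[of l n a] l n by (simp add: an)
    finally show "(cos (real l * (pi / (2 * real n))))\<^sup>2 = (\<Sum>j<n. d j * real (Suc j - l))"
      by (simp add: a_def h_def)
  next
    fix j
    show "\<bar>d j\<bar> \<le> 3 * (pi / (2 * real n))\<^sup>2"
      using diff[of j] aS zero_le_power2[of h] unfolding d_def h_def[symmetric] by (auto split: if_splits)
  qed
qed

text \<open>Fejer kernels are nonnegative, so replacing each \<open>d j\<close> by the bound q of
  its modulus dominates the kernel. The one of order j + 1 contributes the mass q (j + 1) <= q n,
  and there are n of them; q = 3 pi^2 / (4 n^2) keeps the total bounded in n.\<close>

lemma grunwald_kernel_majorant: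
  assumes n: "n \<ge> 1"
  obtains b where "0 < pi * b 0" "pi * b 0 \<le> 3 * pi\<^sup>2"
    "\<And>x t. \<bar>cos_kernel n (\<lambda>j. cos_wt j * (cos (real j * (pi / (2 * real n))))\<^sup>2 / pi) x t\<bar> \<le> cos_kernel n b x t"
proof -
  define q where "q = 3 * (pi / (2 * real n))\<^sup>2"
  have q: "q > 0" using n by (simp add: q_def)
  obtain d where d: "\<And>l. l < n \<Longrightarrow> (cos (real l * (pi / (2 * real n))))\<^sup>2 = (\<Sum>j<n. d j * real (Suc j - l))"
    and dq: "\<And>j. \<bar>d j\<bar> \<le> q"
    by (rule grunwald_multiplier_expansion[OF n, folded q_def]) blast
  define b where "b l = (\<Sum>j<n. q / pi * fejer_coeff (Suc j) l)" for l
  show thesis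
  proof (rule that[of b])
    have b0: "pi * b 0 = q * (\<Sum>j<n. real (Suc j))"
      by (simp add: b_def fejer_coeff_def sum_distrib_left)
    have "(\<Sum>j<n. real (Suc j)) \<ge> (\<Sum>j<n. 1)" by (intro sum_mono) auto
    then have "(\<Sum>j<n. real (Suc j)) > 0" using n by simp
    then show "0 < pi * b 0" unfolding b0 using q by simp
    have "(\<Sum>j<n. real (Suc j)) \<le> (\<Sum>j<n. real n)" by (intro sum_mono) auto
    then have "pi * b 0 \<le> q * (real n * real n)" unfolding b0 using q by simp
    also have "\<dots> = 3 / 4 * pi\<^sup>2" using n by (simp add: q_def power2_eq_square)
    also have "\<dots> \<le> 3 * pi\<^sup>2" by simp
    finally show "pi * b 0 \<le> 3 * pi\<^sup>2" .
    fix x t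
    have "cos_wt l * (cos (real l * (pi / (2 * real n))))\<^sup>2 / pi = (\<Sum>j<n. d j / pi * fejer_coeff (Suc j) l)"
      if "l < n" for l
      unfolding d[OF that] fejer_coeff_def sum_distrib_left sum_divide_distrib by (simp add: mult_ac)
    then have "cos_kernel n (\<lambda>j. cos_wt j * (cos (real j * (pi / (2 * real n))))\<^sup>2 / pi) x t
      = cos_kernel n (\<lambda>l. \<Sum>j<n. d j / pi * fejer_coeff (Suc j) l) x t"
      unfolding cos_kernel_def by (intro sum.cong refl) simp
    also have "\<dots> = (\<Sum>j<n. d j / pi * cos_kernel n (fejer_coeff (Suc j)) x t)"
      by (simp only: cos_kernel_sum)
    also have "\<bar>\<dots>\<bar> \<le> (\<Sum>j<n. \<bar>d j / pi * cos_kernel n (fejer_coeff (Suc j)) x t\<bar>)"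
      by (rule sum_abs)
    also have "\<dots> \<le> (\<Sum>j<n. q / pi * cos_kernel n (fejer_coeff (Suc j)) x t)"
    proof (intro sum_mono)
      fix j assume "j \<in> {..<n}"
      then have "cos_kernel n (fejer_coeff (Suc j)) x t \<ge> 0" by (intro fejer_kernel_nonneg) auto
      then show "\<bar>d j / pi * cos_kernel n (fejer_coeff (Suc j)) x t\<bar>
          \<le> q / pi * cos_kernel n (fejer_coeff (Suc j)) x t"
        using dq[of j] by (simp add: abs_mult mult_right_mono divide_right_mono)
    qed
    also have "\<dots> = cos_kernel n b x t"
      unfolding b_def by (simp only: cos_kernel_sum)
    finally show "\<bar>cos_kernel n (\<lambda>j. cos_wt j * (cos (real j * (pi / (2 * real n))))\<^sup>2 / pi) x t\<bar>
      \<le> cos_kernel n b x t" .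
  qed
qed

subsection \<open>\<open>L\<^sup>p\<close> estimates\<close>

text \<open>Serves both limits in the density proof: truncation of a function, and approximation of
  the truncation by continuous functions.\<close>

lemma Lp_dominated_convergence:
  fixes p :: real
  assumes p: "1 \<le> p" and w: "integrable mu w"
    and s: "\<And>n. s n \<in> borel_measurable mu" and f: "f \<in> borel_measurable mu"
    and lim: "AE x in mu. (\<lambda>n. s n x) \<longlonglongrightarrow> f x"
    and le: "\<And>n. AE x in mu. \<bar>f x - s n x\<bar> powr p \<le> w x"
  shows "(\<lambda>n. \<integral>x. \<bar>f x - s n x\<bar> powr p \<partial>mu) \<longlonglongrightarrow> 0"
proof -
  have "(\<lambda>n. \<integral>x. \<bar>f x - s n x\<bar> powr p \<partial>mu) \<longlonglongrightarrow> (\<integral>x. 0 \<partial>mu)"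
  proof (rule integral_dominated_convergence)
    show "integrable mu w" by (rule w)
    show "(\<lambda>x. \<bar>f x - s n x\<bar> powr p) \<in> borel_measurable mu" for n
      using f s by measurable
    show "AE x in mu. (\<lambda>n. \<bar>f x - s n x\<bar> powr p) \<longlonglongrightarrow> 0"
      using lim
    proof eventually_elim
      case (elim x)
      then have "(\<lambda>n. f x - s n x) \<longlonglongrightarrow> f x - f x" by (intro tendsto_intros)
      then have "(\<lambda>n. \<bar>f x - s n x\<bar>) \<longlonglongrightarrow> 0" using tendsto_rabs_zero by auto
      then show ?case using p by (intro tendsto_zero_powrI[where b = p]) auto
    qed
    show "AE x in mu. norm (\<bar>f x - s n x\<bar> powr p) \<le> w x" for n
      using le[of n] by simp
  qed auto
  then show ?thesis by simp
qed

text \<open>A crude substitute for Minkowski's inequality, from |x + y| <= 2 max (|x|, |y|). The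
  factor 2^p is harmless, as only smallness of p-th powers matters.\<close>

lemma powr_add_le:
  fixes x y p :: real
  assumes "0 \<le> p"
  shows "\<bar>x + y\<bar> powr p \<le> 2 powr p * (\<bar>x\<bar> powr p + \<bar>y\<bar> powr p)"
proof -
  have "\<bar>x + y\<bar> powr p \<le> (2 * max \<bar>x\<bar> \<bar>y\<bar>) powr p"
    using assms by (intro powr_mono2) auto
  also have "\<dots> = 2 powr p * max \<bar>x\<bar> \<bar>y\<bar> powr p"
    by (simp add: powr_mult)
  also have "\<dots> \<le> 2 powr p * (\<bar>x\<bar> powr p + \<bar>y\<bar> powr p)"
    by (intro mult_left_mono) (auto simp: max_def)
  finally show ?thesis .
qed

lemma Lp_space_add:
  assumes p: "1 \<le> p" and f: "f \<in> Lp_space p" and g: "g \<in> Lp_space p"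
  shows "(\<lambda>x. f x + g x) \<in> Lp_space p"
    and "(\<integral>x. \<bar>f x + g x\<bar> powr p \<partial>mu)
      \<le> 2 powr p * ((\<integral>x. \<bar>f x\<bar> powr p \<partial>mu) + (\<integral>x. \<bar>g x\<bar> powr p \<partial>mu))"
proof -
  have m: "f \<in> borel_measurable mu" "g \<in> borel_measurable mu"
    and i: "integrable mu (\<lambda>x. \<bar>f x\<bar> powr p)" "integrable mu (\<lambda>x. \<bar>g x\<bar> powr p)"
    using f g by (auto simp: Lp_space_def)
  have I: "integrable mu (\<lambda>x. 2 powr p * (\<bar>f x\<bar> powr p + \<bar>g x\<bar> powr p))"
    using i by simp
  have J: "integrable mu (\<lambda>x. \<bar>f x + g x\<bar> powr p)"
  proof (rule Bochner_Integration.integrable_bound[OF I])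
    show "(\<lambda>x. \<bar>f x + g x\<bar> powr p) \<in> borel_measurable mu" using m by measurable
    show "AE x in mu. norm (\<bar>f x + g x\<bar> powr p) \<le> norm (2 powr p * (\<bar>f x\<bar> powr p + \<bar>g x\<bar> powr p))"
      using powr_add_le[of p] p by (intro AE_I2) simp
  qed
  then show "(\<lambda>x. f x + g x) \<in> Lp_space p" using m by (auto simp: Lp_space_def)
  have "(\<integral>x. \<bar>f x + g x\<bar> powr p \<partial>mu) \<le> (\<integral>x. 2 powr p * (\<bar>f x\<bar> powr p + \<bar>g x\<bar> powr p) \<partial>mu)"
    using powr_add_le[of p] p by (intro integral_mono J I) auto
  also have "\<dots> = 2 powr p * ((\<integral>x. \<bar>f x\<bar> powr p \<partial>mu) + (\<integral>x. \<bar>g x\<bar> powr p \<partial>mu))"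
    using i by simp
  finally show "(\<integral>x. \<bar>f x + g x\<bar> powr p \<partial>mu) \<le> \<dots>" .
qed

lemma Lp_space_uminus: "f \<in> Lp_space p \<Longrightarrow> (\<lambda>x. - f x) \<in> Lp_space p"
  by (auto simp: Lp_space_def)

lemma Lp_space_diff:
  "1 \<le> p \<Longrightarrow> f \<in> Lp_space p \<Longrightarrow> g \<in> Lp_space p \<Longrightarrow> (\<lambda>x. f x - g x) \<in> Lp_space p"
  using Lp_space_add(1)[of p f "\<lambda>x. - g x"] Lp_space_uminus[of g p] by simp

lemma Lp_space_bounded:
  assumes p: "1 \<le> p" and f: "f \<in> borel_measurable mu" and B: "\<And>x. x \<in> {0..pi} \<Longrightarrow> \<bar>f x\<bar> \<le> B"
  shows "f \<in> Lp_space p" "(\<integral>x. \<bar>f x\<bar> powr p \<partial>mu) \<le> pi * B powr p"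
proof -
  have le: "\<bar>f x\<bar> powr p \<le> B powr p" if "x \<in> space mu" for x
    using B[of x] p that by (intro powr_mono2) auto
  have I: "integrable mu (\<lambda>x. B powr p)"
    by (intro continuous_imp_integrable_real continuous_intros)
  have J: "integrable mu (\<lambda>x. \<bar>f x\<bar> powr p)"
  proof (rule Bochner_Integration.integrable_bound[OF I])
    show "(\<lambda>x. \<bar>f x\<bar> powr p) \<in> borel_measurable mu" using f by measurable
  qed (use le in \<open>auto intro!: AE_I2\<close>)
  then show "f \<in> Lp_space p" using f by (auto simp: Lp_space_def)
  have "(\<integral>x. \<bar>f x\<bar> powr p \<partial>mu) \<le> (\<integral>x. B powr p \<partial>mu)"
    using le by (intro integral_mono J I) auto
  also have "\<dots> = pi * B powr p" by (simp add: measure_restrict_space)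
  finally show "(\<integral>x. \<bar>f x\<bar> powr p \<partial>mu) \<le> pi * B powr p" .
qed

lemma Lp_space_continuous:
  assumes p: "1 \<le> p" and f: "continuous_on {0..pi} f"
  shows "f \<in> Lp_space p"
proof -
  have "compact (f ` {0..pi})" using f by (intro compact_continuous_image) auto
  then obtain B where "\<And>x. x \<in> {0..pi} \<Longrightarrow> \<bar>f x\<bar> \<le> B"
    using compact_imp_bounded[of "f ` {0..pi}"] by (fastforce simp: bounded_iff)
  then show ?thesis
    using f p by (intro Lp_space_bounded(1) continuous_imp_measurable_on_sets_lebesgue) auto
qed

lemma Lp_space_imp_integrable:
  assumes p: "1 \<le> p" and f: "f \<in> Lp_space p"
  shows "integrable mu f"
proof (rule Bochner_Integration.integrable_bound)
  show "integrable mu (\<lambda>x. 1 + \<bar>f x\<bar> powr p)"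
    using f by (auto simp: Lp_space_def intro!: Bochner_Integration.integrable_add continuous_imp_integrable_real)
  show "f \<in> borel_measurable mu" using f by (simp add: Lp_space_def)
  \<comment> \<open>The constant 1, integrable on a finite measure space, covers small values; p >=
    1 covers the large ones.\<close>
  have "\<bar>y\<bar> \<le> 1 + \<bar>y\<bar> powr p" for y :: real
  proof (cases "\<bar>y\<bar> \<le> 1")
    case False
    then have "\<bar>y\<bar> powr 1 \<le> \<bar>y\<bar> powr p" using p by (intro powr_mono) auto
    then show ?thesis by simp
  qed (simp add: add_increasing2)
  then show "AE x in mu. norm (f x) \<le> norm (1 + \<bar>f x\<bar> powr p)"
    by (intro AE_I2) simp
qed

section \<open>Jensen's inequality and the norm bound for dominated kernels\<close>

lemma powr_tangent_le:
  fixes x c p :: real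
  assumes p: "1 \<le> p" and "0 \<le> x" "0 < c"
  shows "c powr p + p * c powr (p - 1) * (x - c) \<le> x powr p"
proof (cases "x = 0")
  \<comment> \<open>Convexity is used on the open half-line only. At x = 0 the tangent has the value
    (1 - p) c^p <= 0.\<close>
  case True
  have "c powr p = c powr (p - 1) * c" using assms by (simp add: powr_mult_base mult.commute)
  then show ?thesis using p True assms by (simp add: mult_right_mono)
next
  case False
  have "convex_on {0<..} (\<lambda>x. x powr p)" using p by (rule powr_convex)
  moreover have "((\<lambda>x. x powr p) has_real_derivative p * c powr (p - 1)) (at c within {0<..})"
    using \<open>0 < c\<close> by (rule has_field_derivative_at_within[OF has_real_derivative_powr])
  ultimately show ?thesis
    using convex_on_imp_above_tangent[of "{0<..}" "\<lambda>x. x powr p" c x "p * c powr (p - 1)"] assms False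
    by (simp add: interior_open)
qed

text \<open>Integrate the tangent line of \<open>x powr p\<close> at the mean value of \<open>\<bar>f\<bar>\<close> with respect to \<open>g dt\<close>.\<close>

lemma jensen_powr:
  assumes p: "1 \<le> p" and f: "f \<in> Lp_space p"
    and g: "continuous_on {0..pi} g" "\<And>t. 0 \<le> g t" and m: "(\<integral>t. g t \<partial>mu) = m" "0 < m"
  shows "(\<integral>t. \<bar>f t\<bar> * g t \<partial>mu) powr p \<le> m powr (p - 1) * (\<integral>t. \<bar>f t\<bar> powr p * g t \<partial>mu)"
proof (cases "(\<integral>t. \<bar>f t\<bar> * g t \<partial>mu) = 0")
  \<comment> \<open>A zero mean is set apart, because the tangent point c must be positive.\<close>
  case True
  then show ?thesis using g by (simp add: integral_nonneg_AE)
next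
  case False
  define a where "a = (\<integral>t. \<bar>f t\<bar> * g t \<partial>mu)"
  have "a \<ge> 0" unfolding a_def using g by (intro integral_nonneg_AE AE_I2) auto
  then have a: "a > 0" using False by (simp add: a_def)
  define c where "c = a / m"
  have c: "c > 0" using a m by (simp add: c_def)
  have fi: "integrable mu (\<lambda>t. \<bar>f t\<bar>)"
    using Lp_space_imp_integrable[OF p f] by simp
  have i1: "integrable mu (\<lambda>t. \<bar>f t\<bar> * g t)"
    by (intro integrable_mult_continuous fi g)
  have i2: "integrable mu g"
    by (intro continuous_imp_integrable_real g)
  have i3: "integrable mu (\<lambda>t. \<bar>f t\<bar> powr p * g t)"
    using f by (intro integrable_mult_continuous g) (simp add: Lp_space_def)
  let ?k = "p * c powr (p - 1)"
  \<comment> \<open>Since a = c m, the linear part of the tangent integrates to zero, which leaves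
    c^p m.\<close>
  have "c powr p * m = (c powr p - ?k * c) * m + ?k * a"
    using m by (simp add: c_def algebra_simps)
  also have "\<dots> = (\<integral>t. (c powr p - ?k * c) * g t + ?k * (\<bar>f t\<bar> * g t) \<partial>mu)"
    using i1 i2 by (simp add: a_def m)
  also have "\<dots> \<le> (\<integral>t. \<bar>f t\<bar> powr p * g t \<partial>mu)"
  proof (rule integral_mono)
    fix t
    have "(c powr p + ?k * (\<bar>f t\<bar> - c)) * g t \<le> \<bar>f t\<bar> powr p * g t"
      using powr_tangent_le[OF p _ c, of "\<bar>f t\<bar>"] g by (intro mult_right_mono) auto
    then show "(c powr p - ?k * c) * g t + ?k * (\<bar>f t\<bar> * g t) \<le> \<bar>f t\<bar> powr p * g t"
      by (simp add: algebra_simps)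
  qed (use i1 i2 i3 in auto)
  finally have le: "c powr p * m \<le> (\<integral>t. \<bar>f t\<bar> powr p * g t \<partial>mu)" .
  have "a powr p = (c * m) powr p" using m by (simp add: c_def)
  also have "\<dots> = c powr p * (m powr (p - 1) * m)"
    using c m by (simp add: powr_mult powr_mult_base mult.commute)
  also have "\<dots> = m powr (p - 1) * (c powr p * m)" by simp
  also have "\<dots> \<le> m powr (p - 1) * (\<integral>t. \<bar>f t\<bar> powr p * g t \<partial>mu)"
    using le by (intro mult_left_mono) auto
  finally show ?thesis by (simp add: a_def)
qed

text \<open>For fixed x, Jensen with the weight \<open>cos_kernel n b x\<close> of mass
  \<open>pi * b 0\<close> gives the factor \<open>(pi * b 0) powr (p - 1)\<close>; integration over
  x by \<open>double_integral_cos_kernel\<close> gives one more factor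
  \<open>pi * b 0\<close>.\<close>

lemma cos_kernel_Lp_bound:
  assumes p: "1 \<le> p" and f: "f \<in> Lp_space p" and n: "n > 0" and b0: "0 < b 0"
    and le: "\<And>x t. \<bar>cos_kernel n a x t\<bar> \<le> cos_kernel n b x t"
  shows "(\<integral>x. \<bar>\<integral>t. f t * cos_kernel n a x t \<partial>mu\<bar> powr p \<partial>mu)
    \<le> (pi * b 0) powr p * (\<integral>t. \<bar>f t\<bar> powr p \<partial>mu)"
proof -
  let ?m = "pi * b 0"
  have m: "?m > 0" using b0 by simp
  have fi: "integrable mu f" by (rule Lp_space_imp_integrable[OF p f])
  have fp: "integrable mu (\<lambda>t. \<bar>f t\<bar> powr p)" using f by (simp add: Lp_space_def)
  have nonneg: "cos_kernel n b x t \<ge> 0" for x t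
    using le[of x t] by linarith
  have pw: "\<bar>\<integral>t. f t * cos_kernel n a x t \<partial>mu\<bar> powr p
      \<le> ?m powr (p - 1) * (\<integral>t. \<bar>f t\<bar> powr p * cos_kernel n b x t \<partial>mu)" for x
  proof -
    have "\<bar>\<integral>t. f t * cos_kernel n a x t \<partial>mu\<bar> \<le> (\<integral>t. \<bar>f t * cos_kernel n a x t\<bar> \<partial>mu)"
      by (rule integral_abs_bound)
    also have "\<dots> \<le> (\<integral>t. \<bar>f t\<bar> * cos_kernel n b x t \<partial>mu)"
      using le by (intro integral_mono integrable_abs integrable_mult_continuous fi continuous_on_cos_kernel)
        (auto simp: abs_mult intro: mult_left_mono)
    finally have "\<bar>\<integral>t. f t * cos_kernel n a x t \<partial>mu\<bar> powr p \<le> (\<integral>t. \<bar>f t\<bar> * cos_kernel n b x t \<partial>mu) powr p"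
      using p by (intro powr_mono2) auto
    also have "\<dots> \<le> ?m powr (p - 1) * (\<integral>t. \<bar>f t\<bar> powr p * cos_kernel n b x t \<partial>mu)"
      using n m nonneg by (intro jensen_powr p f continuous_on_cos_kernel integral_cos_kernel_1) auto
    finally show ?thesis .
  qed
  have c1: "continuous_on {0..pi} (\<lambda>x. \<bar>\<integral>t. f t * cos_kernel n a x t \<partial>mu\<bar> powr p)"
    using p by (intro continuous_on_powr' continuous_intros continuous_on_integral_cos_kernel fi) auto
  have c2: "continuous_on {0..pi} (\<lambda>x. ?m powr (p - 1) * (\<integral>t. \<bar>f t\<bar> powr p * cos_kernel n b x t \<partial>mu))"
    by (intro continuous_intros continuous_on_integral_cos_kernel fp)
  have "(\<integral>x. \<bar>\<integral>t. f t * cos_kernel n a x t \<partial>mu\<bar> powr p \<partial>mu)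
    \<le> (\<integral>x. ?m powr (p - 1) * (\<integral>t. \<bar>f t\<bar> powr p * cos_kernel n b x t \<partial>mu) \<partial>mu)"
    by (intro integral_mono continuous_imp_integrable_real c1 c2 pw)
  also have "\<dots> = ?m powr (p - 1) * (?m * (\<integral>t. \<bar>f t\<bar> powr p \<partial>mu))"
    by (simp only: integral_mult_right_zero double_integral_cos_kernel[OF fp n])
  also have "\<dots> = ?m powr p * (\<integral>t. \<bar>f t\<bar> powr p \<partial>mu)"
    using powr_mult_base[of ?m "p - 1"] m by (simp add: mult_ac)
  finally show ?thesis .
qed

section \<open>Density of the cosine polynomials\<close>

definition cos_poly :: "(real \<Rightarrow> real) \<Rightarrow> bool" where
  "cos_poly g \<longleftrightarrow> (\<exists>N a. \<forall>x. g x = (\<Sum>m<N. a m * cos (real m * x)))"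

lemma cos_polyI: "(\<And>x. g x = (\<Sum>m<N. a m * cos (real m * x))) \<Longrightarrow> cos_poly g"
  unfolding cos_poly_def by blast

text \<open>Zero padding brings two cosine polynomials to a common length, so that they can be added
  coefficientwise.\<close>

lemma cos_poly_pad:
  assumes "\<forall>x. g x = (\<Sum>m<N. a m * cos (real m * x))" "N \<le> M"
  shows "g x = (\<Sum>m<M. (if m < N then a m else 0) * cos (real m * x))"
proof -
  have "(\<Sum>m<M. (if m < N then a m else 0) * cos (real m * x)) = (\<Sum>m<N. a m * cos (real m * x))"
    using assms(2) by (intro sum.mono_neutral_cong_right) auto
  then show ?thesis using assms(1) by simp
qed

lemma cos_poly_add:
  assumes "cos_poly f" "cos_poly g"
  shows "cos_poly (\<lambda>x. f x + g x)"
proof -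
  obtain N a M b where f: "\<forall>x. f x = (\<Sum>m<N. a m * cos (real m * x))"
    and g: "\<forall>x. g x = (\<Sum>m<M. b m * cos (real m * x))"
    using assms unfolding cos_poly_def by blast
  have "f x + g x = (\<Sum>m<max N M. ((if m < N then a m else 0) + (if m < M then b m else 0)) * cos (real m * x))" for x
    using cos_poly_pad[OF f, of "max N M" x] cos_poly_pad[OF g, of "max N M" x]
    by (simp only: sum.distrib distrib_right max.cobounded1 max.cobounded2)
  then show ?thesis by (rule cos_polyI)
qed

lemma cos_poly_cos: "cos_poly (\<lambda>x. c * cos (real m * x))"
proof -
  have "c * cos (real m * x) = (\<Sum>j<Suc m. (if j = m then c else 0) * cos (real j * x))" for x by simp
  then show ?thesis by (rule cos_polyI)
qed

lemma cos_poly_sum: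
  "(\<And>i. i < (n::nat) \<Longrightarrow> cos_poly (f i)) \<Longrightarrow> cos_poly (\<lambda>x. \<Sum>i<n. f i x)"
proof (induction n)
  case 0
  show ?case using cos_poly_cos[of 0 0] by simp
qed (simp add: cos_poly_add)

text \<open>For m > 0, cos x cos (m x) is the mean of the cosines of frequencies m - 1 and m + 1.
  Iterated, this makes the powers of cos x cosine polynomials.\<close>

lemma cos_poly_mult_cos:
  assumes "cos_poly f"
  shows "cos_poly (\<lambda>x. cos x * f x)"
proof -
  obtain N a where f: "\<forall>x. f x = (\<Sum>m<N. a m * cos (real m * x))"
    using assms unfolding cos_poly_def by blast
  have "cos_poly (\<lambda>x. cos x * (a m * cos (real m * x)))" for m
  proof (cases m)
    case 0
    then show ?thesis using cos_poly_cos[of "a 0" 1] by (simp add: mult.commute)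
  next
    case (Suc k)
    have e: "real (Suc k) * x - x = real k * x" "real (Suc k) * x + x = real (Suc (Suc k)) * x" for x
      by (auto simp: algebra_simps)
    have "cos x * (a m * cos (real m * x)) = a m / 2 * cos (real k * x) + a m / 2 * cos (real (Suc (Suc k)) * x)" for x
      unfolding e[symmetric] Suc cos_add cos_diff by (simp add: field_simps)
    then show ?thesis by (simp only: cos_poly_add cos_poly_cos)
  qed
  then have "cos_poly (\<lambda>x. \<Sum>m<N. cos x * (a m * cos (real m * x)))"
    by (intro cos_poly_sum)
  then show ?thesis using f by (simp add: sum_distrib_left)
qed

lemma cos_poly_power_cos: "cos_poly (\<lambda>x. c * cos x ^ i)"
proof (induction i)
  case 0
  show ?case using cos_poly_cos[of c 0] by simp
next
  case (Suc i)
  then show ?case using cos_poly_mult_cos[OF Suc] by (simp add: mult.left_commute)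
qed

text \<open>The substitution y = cos x carries [0, pi] to [-1, 1], where Weierstrass supplies a
  polynomial q; then q (cos x) is a cosine polynomial.\<close>

lemma continuous_cos_poly_approx:
  assumes f: "continuous_on {0..pi} f" and e: "e > 0"
  obtains g where "cos_poly g" "\<And>x. x \<in> {0..pi} \<Longrightarrow> \<bar>f x - g x\<bar> < e"
proof -
  have "continuous_on {-1..1} (\<lambda>y. f (arccos y))"
    by (rule continuous_on_compose2[OF f]) (auto intro!: continuous_intros arccos_lbound arccos_ubound)
  then obtain q where q: "real_polynomial_function q" "\<And>y. y \<in> {-1..1} \<Longrightarrow> \<bar>f (arccos y) - q y\<bar> < e"
    using Stone_Weierstrass_real_polynomial_function[of "{-1..1}" "\<lambda>y. f (arccos y)" e] e by auto
  then obtain a n where qa: "q = (\<lambda>y. \<Sum>i\<le>n. a i * y ^ i)"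
    unfolding real_polynomial_function_iff_sum by blast
  show thesis
  proof (rule that[of "\<lambda>x. q (cos x)"])
    show "cos_poly (\<lambda>x. q (cos x))"
      unfolding qa lessThan_Suc_atMost[symmetric] by (intro cos_poly_sum cos_poly_power_cos)
    show "\<bar>f x - q (cos x)\<bar> < e" if "x \<in> {0..pi}" for x
      using q(2)[of "cos x"] that by (simp add: arccos_cos)
  qed
qed

lemma cos_poly_continuous: "cos_poly g \<Longrightarrow> continuous_on A g"
proof -
  assume "cos_poly g"
  then obtain N a where "g = (\<lambda>x. \<Sum>m<N. a m * cos (real m * x))"
    unfolding cos_poly_def by blast
  then show ?thesis by (auto intro!: continuous_intros)
qed

text \<open>Three approximations in turn: \<open>f\<close> by its truncation \<open>F\<close> at
  height k, \<open>F\<close> by a continuous \<open>H\<close>, and \<open>H\<close> uniformly by a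
  cosine polynomial \<open>q\<close>.\<close>

lemma Lp_cos_poly_dense:
  assumes p: "1 \<le> p" and f: "f \<in> Lp_space p" and e: "e > 0"
  obtains g where "cos_poly g" "(\<integral>x. \<bar>f x - g x\<bar> powr p \<partial>mu) < e"
proof -
  define T where "T B y = max (- B) (min B y)" for B y :: real
  define c :: real where "c = 2 powr p"
  have c: "c \<ge> 1" using p by (simp add: c_def ge_one_powr_ge_zero)
  \<comment> \<open>The two uses of the quasi-triangle inequality cost c (e1 + 2 c e1) <= 3 c^2 e1 =
    e.\<close>
  define e1 where "e1 = e / (3 * c\<^sup>2)"
  have e1: "e1 > 0" using e c by (simp add: e1_def)
  have fm: "f \<in> borel_measurable mu" and fi: "integrable mu (\<lambda>x. \<bar>f x\<bar> powr p)"
    using f by (auto simp: Lp_space_def)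
  have Tm: "(\<lambda>x. T B (g x)) \<in> borel_measurable mu" if "g \<in> borel_measurable mu" for B g
    using that unfolding T_def by measurable
  have Tb: "\<bar>T (real k) y\<bar> \<le> real k" for k y by (auto simp: T_def)
  have "(\<lambda>k. \<integral>x. \<bar>f x - T (real k) (f x)\<bar> powr p \<partial>mu) \<longlonglongrightarrow> 0"
  proof (rule Lp_dominated_convergence[OF p fi _ fm])
    show "AE x in mu. (\<lambda>k. T (real k) (f x)) \<longlonglongrightarrow> f x"
    proof (rule AE_I2)
      fix x
      obtain K where "\<bar>f x\<bar> \<le> real K" using real_arch_simple by blast
      then have "\<forall>k\<ge>K. T (real k) (f x) = f x" by (auto simp: T_def max_def min_def)
      then show "(\<lambda>k. T (real k) (f x)) \<longlonglongrightarrow> f x"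
        by (intro tendsto_eventually) (auto simp: eventually_sequentially)
    qed
    have "\<bar>y - T (real k) y\<bar> \<le> \<bar>y\<bar>" for k y by (auto simp: T_def max_def min_def)
    then show "AE x in mu. \<bar>f x - T (real k) (f x)\<bar> powr p \<le> \<bar>f x\<bar> powr p" for k
      using p by (intro AE_I2 powr_mono2) auto
  qed (use Tm fm in auto)
  then have "eventually (\<lambda>k. (\<integral>x. \<bar>f x - T (real k) (f x)\<bar> powr p \<partial>mu) < e1) sequentially"
    using e1 by (rule order_tendstoD)
  then obtain k where k: "(\<integral>x. \<bar>f x - T (real k) (f x)\<bar> powr p \<partial>mu) < e1"
    by (auto simp: eventually_sequentially)
  define F where "F x = T (real k) (f x)" for x
  have Fm: "F \<in> borel_measurable mu" unfolding F_def by (rule Tm[OF fm])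
  then have FL: "F \<in> Lp_space p" using Tb unfolding F_def by (intro Lp_space_bounded(1)[OF p])
  \<comment> \<open>\<open>measurable_on\<close> yields continuous functions converging to
    \<open>F\<close> off a negligible set. Truncating them at height k too provides the dominating
    constant (2 k)^p and leaves the limit unchanged.\<close>
  have "F measurable_on {0..pi}"
    using Fm by (simp add: measurable_on_iff_borel_measurable)
  then obtain N g where N: "negligible N" and gc: "\<And>n. continuous_on UNIV (g n)"
    and gl: "\<And>x. x \<notin> N \<Longrightarrow> (\<lambda>n. g n x) \<longlonglongrightarrow> (if x \<in> {0..pi} then F x else 0)"
    unfolding measurable_on_def by metis
  have gc': "continuous_on {0..pi} (\<lambda>x. T (real k) (g n x))" for n
    unfolding T_def using continuous_on_subset[OF gc] by (intro continuous_intros) auto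
  have "(\<lambda>n. \<integral>x. \<bar>F x - T (real k) (g n x)\<bar> powr p \<partial>mu) \<longlonglongrightarrow> 0"
  proof (rule Lp_dominated_convergence[OF p _ _ Fm])
    show "integrable mu (\<lambda>x. (2 * real k) powr p)"
      by (intro continuous_imp_integrable_real continuous_intros)
    show "(\<lambda>x. T (real k) (g n x)) \<in> borel_measurable mu" for n
      by (intro continuous_imp_measurable_on_sets_lebesgue gc') auto
    have "N \<in> null_sets lebesgue" using N by (simp add: negligible_iff_null_sets)
    then have "AE x in lebesgue. x \<notin> N" by (rule AE_not_in)
    then have "AE x in mu. x \<notin> N" by (subst AE_restrict_space_iff) auto
    then show "AE x in mu. (\<lambda>n. T (real k) (g n x)) \<longlonglongrightarrow> F x"
    proof (rule AE_mp, intro AE_I2 impI)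
      fix x assume x: "x \<in> space mu" "x \<notin> N"
      then have "(\<lambda>n. g n x) \<longlonglongrightarrow> F x" using gl[of x] by simp
      then have "(\<lambda>n. T (real k) (g n x)) \<longlonglongrightarrow> T (real k) (F x)"
        unfolding T_def by (intro tendsto_intros)
      also have "T (real k) (F x) = F x" by (auto simp: F_def T_def max_def min_def)
      finally show "(\<lambda>n. T (real k) (g n x)) \<longlonglongrightarrow> F x" .
    qed
    have "\<bar>F x - T (real k) (g n x)\<bar> \<le> 2 * real k" for n x
      using Tb[of k "f x"] Tb[of k "g n x"] unfolding F_def by linarith
    then show "AE x in mu. \<bar>F x - T (real k) (g n x)\<bar> powr p \<le> (2 * real k) powr p" for n
      using p by (intro AE_I2 powr_mono2) auto
  qed
  then have "eventually (\<lambda>n. (\<integral>x. \<bar>F x - T (real k) (g n x)\<bar> powr p \<partial>mu) < e1) sequentially"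
    using e1 by (rule order_tendstoD)
  then obtain n where n: "(\<integral>x. \<bar>F x - T (real k) (g n x)\<bar> powr p \<partial>mu) < e1"
    by (auto simp: eventually_sequentially)
  define H where "H x = T (real k) (g n x)" for x
  have Hc: "continuous_on {0..pi} H" unfolding H_def by (rule gc')
  \<comment> \<open>Chosen so that pi d^p = e1 / 2.\<close>
  define d where "d = (e1 / (2 * pi)) powr (1 / p)"
  have d: "d > 0" using e1 by (simp add: d_def)
  obtain q where q: "cos_poly q" "\<And>x. x \<in> {0..pi} \<Longrightarrow> \<bar>H x - q x\<bar> < d"
    using continuous_cos_poly_approx[OF Hc d] by blast
  have qc: "continuous_on {0..pi} q" using q(1) by (rule cos_poly_continuous)
  have HL: "H \<in> Lp_space p" and qL: "q \<in> Lp_space p"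
    by (intro Lp_space_continuous p Hc qc)+
  have "(\<integral>x. \<bar>H x - q x\<bar> powr p \<partial>mu) \<le> pi * d powr p"
    using q(2) Hc qc
    by (intro Lp_space_bounded(2)[OF p] continuous_imp_measurable_on_sets_lebesgue continuous_intros)
      (auto intro: less_imp_le)
  also have "\<dots> < e1" using e1 p by (simp add: d_def powr_powr)
  finally have l3: "(\<integral>x. \<bar>H x - q x\<bar> powr p \<partial>mu) < e1" .
  have l2: "(\<integral>x. \<bar>F x - q x\<bar> powr p \<partial>mu) \<le> c * (2 * e1)"
  proof -
    have "(\<integral>x. \<bar>(F x - H x) + (H x - q x)\<bar> powr p \<partial>mu)
      \<le> c * ((\<integral>x. \<bar>F x - H x\<bar> powr p \<partial>mu) + (\<integral>x. \<bar>H x - q x\<bar> powr p \<partial>mu))"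
      unfolding c_def by (intro Lp_space_add(2) Lp_space_diff p FL HL qL)
    also have "\<dots> \<le> c * (e1 + e1)"
      using c n l3 by (intro mult_left_mono add_mono) (auto simp: H_def)
    finally show ?thesis by simp
  qed
  have "(\<integral>x. \<bar>(f x - F x) + (F x - q x)\<bar> powr p \<partial>mu)
      \<le> c * ((\<integral>x. \<bar>f x - F x\<bar> powr p \<partial>mu) + (\<integral>x. \<bar>F x - q x\<bar> powr p \<partial>mu))"
    unfolding c_def by (intro Lp_space_add(2) Lp_space_diff p FL f qL)
  also have "\<dots> < c * (e1 + c * (2 * e1))"
    using c k l2 by (intro mult_strict_left_mono add_less_le_mono) (auto simp: F_def)
  also have "\<dots> \<le> c * (c * e1 + c * (2 * e1))"
    using c e1 by (intro mult_left_mono add_right_mono) auto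
  also have "\<dots> = e" using c by (simp add: e1_def power2_eq_square)
  finally show thesis using that[OF q(1)] by simp
qed

subsection \<open>Convergence\<close>

lemma grunwald_durrmeyer_continuous:
  assumes "n \<ge> 1" "integrable mu f"
  shows "continuous_on A (grunwald_durrmeyer n f)"
  using continuous_on_integral_cos_kernel[OF assms(2)]
  by (simp add: grunwald_durrmeyer_eq[OF assms, abs_def])

lemma grunwald_durrmeyer_diff:
  assumes n: "n \<ge> 1" and f: "integrable mu f" and g: "integrable mu g"
  shows "grunwald_durrmeyer n (\<lambda>t. f t - g t) x = grunwald_durrmeyer n f x - grunwald_durrmeyer n g x"
proof -
  have "integrable mu (\<lambda>t. f t - g t)" using f g by simp
  then show ?thesis
    unfolding grunwald_durrmeyer_eq[OF n f] grunwald_durrmeyer_eq[OF n g]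
    by (simp add: grunwald_durrmeyer_eq[OF n] left_diff_distrib integrable_mult_continuous
        continuous_on_cos_kernel f g)
qed

text \<open>The constant is independent of n; this uniformity carries convergence from cosine
  polynomials to the whole space.\<close>

lemma grunwald_durrmeyer_bound:
  assumes p: "1 \<le> p" and f: "f \<in> Lp_space p" and n: "n \<ge> 1"
  shows "(\<integral>x. \<bar>grunwald_durrmeyer n f x\<bar> powr p \<partial>mu) \<le> (3 * pi\<^sup>2) powr p * (\<integral>x. \<bar>f x\<bar> powr p \<partial>mu)"
proof -
  obtain b where b: "0 < pi * b 0" "pi * b 0 \<le> 3 * pi\<^sup>2"
    and le: "\<And>x t. \<bar>cos_kernel n (\<lambda>j. cos_wt j * (cos (real j * (pi / (2 * real n))))\<^sup>2 / pi) x t\<bar> \<le> cos_kernel n b x t"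
    using grunwald_kernel_majorant[OF n] by blast
  have "(\<integral>x. \<bar>grunwald_durrmeyer n f x\<bar> powr p \<partial>mu) \<le> (pi * b 0) powr p * (\<integral>x. \<bar>f x\<bar> powr p \<partial>mu)"
    unfolding grunwald_durrmeyer_eq[OF n Lp_space_imp_integrable[OF p f]]
    using b(1) n by (intro cos_kernel_Lp_bound p f le) (auto simp: zero_less_mult_iff)
  also have "\<dots> \<le> (3 * pi\<^sup>2) powr p * (\<integral>x. \<bar>f x\<bar> powr p \<partial>mu)"
    using b p by (intro mult_right_mono powr_mono2) (auto intro: integral_nonneg_AE)
  finally show ?thesis .
qed

text \<open>For n >= N no frequency of \<open>g\<close> is cut off, and the factor
  \<open>cos_wt j / pi\<close> in the kernel cancels the squared norm \<open>pi / cos_wt j\<close>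
  of the cosine.\<close>

lemma grunwald_durrmeyer_cos_poly:
  assumes g: "\<And>x. g x = (\<Sum>m<N. a m * cos (real m * x))" and n: "n \<ge> 1" "N \<le> n"
  shows "grunwald_durrmeyer n g x
    = (\<Sum>m<N. (cos (real m * (pi / (2 * real n))))\<^sup>2 * (a m * cos (real m * x)))"
proof -
  have "continuous_on {0..pi} g" unfolding g[abs_def] by (intro continuous_intros)
  then have gi: "integrable mu g" by (rule continuous_imp_integrable_real)
  have coeff: "(\<integral>t. g t * cos (real j * t) \<partial>mu) = (if j < N then a j * pi / cos_wt j else 0)" for j
  proof -
    have I: "integrable mu (\<lambda>t. a m * (cos (real m * t) * cos (real j * t)))" for m
      by (intro continuous_imp_integrable_real continuous_intros)
    have "(\<integral>t. g t * cos (real j * t) \<partial>mu) = (\<integral>t. (\<Sum>m<N. a m * (cos (real m * t) * cos (real j * t))) \<partial>mu)"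
      unfolding g by (simp only: sum_distrib_right mult.assoc)
    also have "\<dots> = (\<Sum>m<N. a m * (\<integral>t. cos (real m * t) * cos (real j * t) \<partial>mu))"
      by (subst Bochner_Integration.integral_sum) (rule I, simp)
    also have "\<dots> = (\<Sum>m<N. if m = j then a m * pi / cos_wt m else 0)"
      by (intro sum.cong) (auto simp: integral_cos_cos)
    finally show ?thesis by simp
  qed
  have "grunwald_durrmeyer n g x = (\<Sum>j<n. cos_wt j * (cos (real j * (pi / (2 * real n))))\<^sup>2 / pi
      * (if j < N then a j * pi / cos_wt j else 0) * cos (real j * x))"
    unfolding grunwald_durrmeyer_eq[OF n(1) gi] integral_cos_kernel[OF gi] coeff ..
  also have "\<dots> = (\<Sum>m<N. (cos (real m * (pi / (2 * real n))))\<^sup>2 * (a m * cos (real m * x)))"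
    using n(2) by (intro sum.mono_neutral_cong_right) auto
  finally show ?thesis .
qed

lemma grunwald_durrmeyer_cos_poly_tendsto:
  assumes p: "1 \<le> p" and g: "cos_poly g"
  shows "(\<lambda>n. \<integral>x. \<bar>grunwald_durrmeyer n g x - g x\<bar> powr p \<partial>mu) \<longlonglongrightarrow> 0"
proof -
  obtain N a where g: "\<And>x. g x = (\<Sum>m<N. a m * cos (real m * x))"
    using g unfolding cos_poly_def by blast
  \<comment> \<open>As |cos (m x)| <= 1, \<open>E n\<close> bounds the uniform error once n >= max 1
    N; it tends to 0 because every multiplier tends to 1.\<close>
  define E where "E n = (\<Sum>m<N. \<bar>(cos (real m * (pi / (2 * real n))))\<^sup>2 - 1\<bar> * \<bar>a m\<bar>)" for n
  have gc: "continuous_on {0..pi} g" unfolding g[abs_def] by (intro continuous_intros)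
  have gi: "integrable mu g" by (intro continuous_imp_integrable_real gc)
  have "(\<lambda>n. pi / (2 * real n)) \<longlonglongrightarrow> 0"
    using tendsto_mult_right_zero[OF lim_inverse_n', of "pi / 2"] by (simp add: field_simps)
  then have "E \<longlonglongrightarrow> (\<Sum>m<N. \<bar>(cos (real m * 0))\<^sup>2 - 1\<bar> * \<bar>a m\<bar>)"
    unfolding E_def by (intro tendsto_intros)
  then have E0: "E \<longlonglongrightarrow> 0" by simp
  have En: "E n \<ge> 0" for n unfolding E_def by (intro sum_nonneg) auto
  have "(\<lambda>n. E n powr p) \<longlonglongrightarrow> 0"
    using E0 En p by (intro tendsto_zero_powrI[where b = p]) auto
  then have lim: "(\<lambda>n. pi * E n powr p) \<longlonglongrightarrow> 0"
    by (rule tendsto_mult_right_zero)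
  have ub: "(\<integral>x. \<bar>grunwald_durrmeyer n g x - g x\<bar> powr p \<partial>mu) \<le> pi * E n powr p"
    if n: "n \<ge> max 1 N" for n
  proof (rule Lp_space_bounded(2)[OF p])
    show "(\<lambda>x. grunwald_durrmeyer n g x - g x) \<in> borel_measurable mu"
      using n by (intro continuous_imp_measurable_on_sets_lebesgue continuous_intros gc
          grunwald_durrmeyer_continuous gi) auto
    fix x
    have "grunwald_durrmeyer n g x - g x
      = (\<Sum>m<N. ((cos (real m * (pi / (2 * real n))))\<^sup>2 - 1) * (a m * cos (real m * x)))"
      using grunwald_durrmeyer_cos_poly[OF g, of n x] n g[of x]
      by (simp add: sum_subtractf left_diff_distrib)
    also have "\<bar>\<dots>\<bar> \<le> (\<Sum>m<N. \<bar>((cos (real m * (pi / (2 * real n))))\<^sup>2 - 1) * (a m * cos (real m * x))\<bar>)"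
      by (rule sum_abs)
    also have "\<dots> \<le> E n"
      unfolding E_def abs_mult by (intro sum_mono mult_left_mono) (auto simp: mult_left_le)
    finally show "\<bar>grunwald_durrmeyer n g x - g x\<bar> \<le> E n" .
  qed
  show ?thesis
    by (rule tendsto_sandwich[OF _ _ tendsto_const lim])
      (use ub in \<open>auto intro: integral_nonneg_AE eventually_sequentiallyI[of "max 1 N"]\<close>)
qed

theorem corollary4p7:
  fixes p :: real
  assumes "1 \<le> p"
  shows "(\<forall>n\<ge>1. \<forall>f\<in>Lp_space p. grunwald_durrmeyer n f \<in> Lp_space p) \<and>
         (\<forall>f\<in>Lp_space p. (\<lambda>n. Lp_norm p (\<lambda>t. grunwald_durrmeyer n f t - f t)) \<longlonglongrightarrow> 0)"
proof (intro conjI ballI allI impI)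
  note p = assms
  show L: "grunwald_durrmeyer n f \<in> Lp_space p" if "n \<ge> 1" "f \<in> Lp_space p" for n f
    by (rule Lp_space_continuous[OF p grunwald_durrmeyer_continuous[OF that(1) Lp_space_imp_integrable[OF p that(2)]]])
  fix f assume f: "f \<in> Lp_space p"
  define c :: real where "c = 2 powr p"
  have c: "c > 0" by (simp add: c_def)
  define M where "M = (3 * pi\<^sup>2) powr p"
  have M: "M > 0" by (simp add: M_def)
  define R where "R n = (\<integral>x. \<bar>grunwald_durrmeyer n f x - f x\<bar> powr p \<partial>mu)" for n
  have Rn: "R n \<ge> 0" for n unfolding R_def by (intro integral_nonneg_AE) auto
  \<comment> \<open>\<open>R n\<close> is the p-th power of the norm of the error; the root is taken
    at the end.\<close>
  have "R \<longlonglongrightarrow> 0"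
  proof (rule order_tendstoI)
    show "eventually (\<lambda>n. a < R n) sequentially" if "a < 0" for a
      using Rn that by (auto intro: always_eventually less_le_trans)
    fix e :: real assume e: "e > 0"
    have K: "c * (M + c) \<noteq> 0" using c M by auto
    \<comment> \<open>The two terms with f - g contribute c M d and c^2 d, together c (M + c) d = e
      / 2.\<close>
    define d where "d = e / 2 / (c * (M + c))"
    have d: "d > 0" using e c M by (simp add: d_def)
    obtain g where g: "cos_poly g" "(\<integral>x. \<bar>f x - g x\<bar> powr p \<partial>mu) < d"
      using Lp_cos_poly_dense[OF p f d] by blast
    have gL: "g \<in> Lp_space p"
      by (intro Lp_space_continuous p cos_poly_continuous g)
    have hL: "(\<lambda>x. f x - g x) \<in> Lp_space p"
      by (intro Lp_space_diff p f gL)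
    let ?G = "\<lambda>n. \<integral>x. \<bar>grunwald_durrmeyer n g x - g x\<bar> powr p \<partial>mu"
    \<comment> \<open>\<open>?G n\<close> enters the final estimate with the factor c^2, so it
      contributes less than the other e / 2.\<close>
    have "eventually (\<lambda>n. ?G n < e / (2 * c\<^sup>2)) sequentially"
      using grunwald_durrmeyer_cos_poly_tendsto[OF p g(1)] e c by (intro order_tendstoD) auto
    then show "eventually (\<lambda>n. R n < e) sequentially"
      using eventually_ge_at_top[of 1]
    proof eventually_elim
      case (elim n)
      let ?D = "grunwald_durrmeyer n"
      have n: "n \<ge> 1" using elim by simp
      \<comment> \<open>The image of f - g is controlled by the uniform bound, the middle term by
        convergence on cosine polynomials, and the last by density.\<close>
      have eq: "?D f x - f x = ?D (\<lambda>t. f t - g t) x + ((?D g x - g x) + - (f x - g x))" for x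
        using grunwald_durrmeyer_diff[OF n Lp_space_imp_integrable[OF p f] Lp_space_imp_integrable[OF p gL]]
        by simp
      have "R n \<le> c * ((\<integral>x. \<bar>?D (\<lambda>t. f t - g t) x\<bar> powr p \<partial>mu)
          + (\<integral>x. \<bar>(?D g x - g x) + - (f x - g x)\<bar> powr p \<partial>mu))"
        unfolding R_def eq c_def
        by (intro Lp_space_add p L n hL Lp_space_diff Lp_space_uminus gL)
      also have "\<dots> \<le> c * (M * d + c * (?G n + d))"
      proof (intro mult_left_mono add_mono)
        show "(\<integral>x. \<bar>?D (\<lambda>t. f t - g t) x\<bar> powr p \<partial>mu) \<le> M * d"
          using grunwald_durrmeyer_bound[OF p hL n] mult_left_mono[OF less_imp_le[OF g(2)], of M] M
          unfolding M_def by linarith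
        have "(\<integral>x. \<bar>(?D g x - g x) + - (f x - g x)\<bar> powr p \<partial>mu)
          \<le> c * (?G n + (\<integral>x. \<bar>- (f x - g x)\<bar> powr p \<partial>mu))"
          unfolding c_def by (intro Lp_space_add p L n hL Lp_space_diff Lp_space_uminus gL)
        also have "\<dots> \<le> c * (?G n + d)"
          using g(2) c by (intro mult_left_mono add_left_mono) (auto simp: abs_minus_commute)
        finally show "(\<integral>x. \<bar>(?D g x - g x) + - (f x - g x)\<bar> powr p \<partial>mu) \<le> c * (?G n + d)" .
      qed (use c in auto)
      also have "\<dots> = c\<^sup>2 * ?G n + c * (M + c) * d"
        by (simp add: algebra_simps power2_eq_square)
      also have "c * (M + c) * d = e / 2"
        unfolding d_def times_divide_eq_right[of "c * (M + c)" "e / 2"]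
        by (rule nonzero_mult_div_cancel_left[OF K])
      also have "c\<^sup>2 * ?G n + e / 2 < c\<^sup>2 * (e / (2 * c\<^sup>2)) + e / 2"
        using elim c by (intro add_strict_right_mono mult_strict_left_mono) auto
      also have "\<dots> = e" using c by simp
      finally show "R n < e" .
    qed
  qed
  then have "(\<lambda>n. R n powr (1 / p)) \<longlonglongrightarrow> 0"
    using Rn p by (intro tendsto_zero_powrI[where b = "1 / p"]) auto
  then show "(\<lambda>n. Lp_norm p (\<lambda>t. grunwald_durrmeyer n f t - f t)) \<longlonglongrightarrow> 0"
    by (simp add: R_def Lp_norm_def)
qed

end
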